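(* (Classical MDP as a special case.) Let $H:P(E\times S)\to\mathbb{R}$ be given by $H(F)=\sum_{x,s}(g(x)+s)F(x,s)$. For $F\in P(E\times S)$ define $J_N(F):=H(F)$ and $J_n(F):=\sup_{\pi\in\Pi^M}J_{n+1}(T^\pi(F))$, $n=0,1,\ldots,N-1$. Let $V_N:=g$ and, for $n=N-1,\ldots,0$, let $$V_n(x)=\max_{a\in A}\Big\{r(x,a)+\sum_{x'}V_{n+1}(x')q(x'|x,a)\Big\},\qquad x\in E,$$ be the value functions of the classical Bellman equation. Then for all $n=0,1,\ldots,N$ and $F\in P(E\times S)$, $$J_n(F)=\sum_{s}s\,F(E,s)+\sum_{x}F(x,S)\,V_n(x),$$ where $F(E,s)=\sum_{x\in E}F(x,s)$ and $F(x,S)=\sum_{s\in S}F(x,s)$. In particular, the optimal strategy does not depend on $F$ and is deterministic.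
   Context: MDP data: $E$ is a finite state space, $A$ a finite action space, $r:E\times A\to\mathbb{R}$ the one-stage reward, $q$ the transition probability from $E\times A$ to $E$, $g:E\to\mathbb{R}$ the terminal reward, $N\in\mathbb{N}$ the time horizon. $P(Y)$ is the set of all probability distributions on $Y$. With $X_k$, $A_k$ the state and action at time $k$, the accumulated rewards are $R_n=\sum_{k=0}^n r(X_k,A_k)$ for $n=0,\ldots,N-1$ and $R_N=\sum_{k=0}^{N-1}r(X_k,A_k)+g(X_N)$. $S$ is the finite set of all possible realizations of $R_0,R_1,\ldots,R_N$. Lifted MDP (deterministic control problem): the state space is $P(E\times S)$, where a state $F_n$ at time $n$ is interpreted as the joint distribution of $(X_n,R_{n-1})$; the action space is $\Pi^M=\{\pi:E\times S\to P(A)\}$, written $\pi(a|x,s)$; the one-stage reward is zero and the terminal reward is $H$; the transition function $T:P(E\times S)\times\Pi^M\to P(E\times S)$ is $$T^\pi(F)(x',s')=T(F,\pi)(x',s')=\sum_{(x,s,a):\ r(x,a)=s'-s}q(x'|x,a)\,\pi(a|x,s)\,F(x,s),\qquad (x',s')\in E\times S.$$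
   Formalization: T does not map P(E×S) into itself, since s+r(x,a) may leave the finite set S; here T, Π^M and J_n are defined by the same formulas with accumulated rewards in ℝ instead of S, and S also contains R_{-1}=0. The claim still covers all F in P(E×S). *)

theory Defs
  imports "HOL-Probability.Probability"
begin

text \<open>
  The finite state space is a type \<open>'e :: finite\<close>, the finite action space a type
  \<open>'a :: finite\<close>, and \<open>q x a\<close> is the distribution of the next state, so that
  \<open>pmf (q x a) x'\<close> is \<open>q(x'|x,a)\<close>.
\<close>

definition dists :: "'b set \<Rightarrow> 'b pmf set" where
  "dists Y = {p. set_pmf p \<subseteq> Y}"

text \<open>
  The random variables are read on the canonical space of all state/action paths, and
  \<open>acc_reward r xs as n\<close> is $R_{n-1}$ for \<open>n \<le> N\<close>. The empty sum \<open>n = 0\<close> is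
  $R_{-1} = 0$; it has to be a possible value because the state at time 0 is the joint
  distribution of $(X_0, R_{-1})$.
\<close>

definition acc_reward ::
    "('e \<Rightarrow> 'a \<Rightarrow> real) \<Rightarrow> (nat \<Rightarrow> 'e) \<Rightarrow> (nat \<Rightarrow> 'a) \<Rightarrow> nat \<Rightarrow> real" where
  "acc_reward r xs as n = (\<Sum>k<n. r (xs k) (as k))"

definition reward_values :: "('e \<Rightarrow> 'a \<Rightarrow> real) \<Rightarrow> ('e \<Rightarrow> real) \<Rightarrow> nat \<Rightarrow> real set" where
  "reward_values r g N =
     {acc_reward r xs as n | xs as n. n \<le> N} \<union> {acc_reward r xs as N + g (xs N) | xs as. True}"

text \<open>
  No nonempty finite \<open>S\<close> is closed under adding rewards, unless all rewards vanish, so the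
  transition function cannot map all of $P(E \times S)$ into itself: mass at
  \<open>(x, s)\<close> moves to the reward \<open>s + r x a\<close>, which may lie outside \<open>S\<close>.
  The dynamics are therefore defined by the same formula on distributions on
  $E \times \mathbb{R}$. They agree with the dynamics on $P(E \times S)$ wherever the latter
  stay in $P(E \times S)$, in particular for the joint distributions of
  $(X_n, R_{n-1})$, see \<open>lifted_transition_accumulated\<close> below. The value of
  \<open>embed_pmf\<close> is the intended one by \<open>pmf_lifted_transition\<close>.
\<close>

type_synonym ('e, 'a) rule = "'e \<times> real \<Rightarrow> 'a pmf"

definition lifted_transition ::
    "('e \<Rightarrow> 'a \<Rightarrow> real) \<Rightarrow> ('e \<Rightarrow> 'a \<Rightarrow> 'e pmf) \<Rightarrow> ('e, 'a) rule
      \<Rightarrow> ('e \<times> real) pmf \<Rightarrow> ('e \<times> real) pmf" where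
  "lifted_transition r q \<pi> F = embed_pmf (\<lambda>(x', s').
     \<Sum>(x, s, a) \<in> {(x, s, a). r x a = s' - s}.
       pmf (q x a) x' * pmf (\<pi> (x, s)) a * pmf F (x, s))"

function lifted_value ::
    "('e \<Rightarrow> 'a \<Rightarrow> real) \<Rightarrow> ('e \<Rightarrow> 'a \<Rightarrow> 'e pmf) \<Rightarrow> (('e \<times> real) pmf \<Rightarrow> real) \<Rightarrow> nat
      \<Rightarrow> nat \<Rightarrow> ('e \<times> real) pmf \<Rightarrow> real" where
  "lifted_value r q H N n F =
     (if n < N then (SUP \<pi>. lifted_value r q H N (Suc n) (lifted_transition r q \<pi> F)) else H F)"
  by auto
termination
  by (relation "Wellfounded.measure (\<lambda>(r, q, H, N, n, F). N - n)") auto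

declare lifted_value.simps [simp del]

text \<open>
  Terminal reward collected from time \<open>n\<close> on, starting in \<open>F\<close>, when the decision
  rule \<open>\<sigma> k\<close> is used at time \<open>k\<close>.
\<close>

function strategy_value ::
    "('e \<Rightarrow> 'a \<Rightarrow> real) \<Rightarrow> ('e \<Rightarrow> 'a \<Rightarrow> 'e pmf) \<Rightarrow> (('e \<times> real) pmf \<Rightarrow> real) \<Rightarrow> nat
      \<Rightarrow> (nat \<Rightarrow> ('e, 'a) rule) \<Rightarrow> nat \<Rightarrow> ('e \<times> real) pmf \<Rightarrow> real" where
  "strategy_value r q H N \<sigma> n F =
     (if n < N then strategy_value r q H N \<sigma> (Suc n) (lifted_transition r q (\<sigma> n) F) else H F)"
  by auto
termination
  by (relation "Wellfounded.measure (\<lambda>(r, q, H, N, \<sigma>, n, F). N - n)") auto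

declare strategy_value.simps [simp del]

definition optimal_strategy ::
    "('e \<Rightarrow> 'a \<Rightarrow> real) \<Rightarrow> ('e \<Rightarrow> 'a \<Rightarrow> 'e pmf) \<Rightarrow> (('e \<times> real) pmf \<Rightarrow> real) \<Rightarrow> nat
      \<Rightarrow> (nat \<Rightarrow> ('e, 'a) rule) \<Rightarrow> nat \<Rightarrow> ('e \<times> real) pmf \<Rightarrow> bool" where
  "optimal_strategy r q H N \<sigma> n F \<longleftrightarrow>
     (\<forall>\<tau>. strategy_value r q H N \<tau> n F \<le> strategy_value r q H N \<sigma> n F)"

function bellman_value ::
    "('e::finite \<Rightarrow> 'a::finite \<Rightarrow> real) \<Rightarrow> ('e \<Rightarrow> 'a \<Rightarrow> 'e pmf) \<Rightarrow> ('e \<Rightarrow> real) \<Rightarrow> nat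
      \<Rightarrow> nat \<Rightarrow> 'e \<Rightarrow> real" where
  "bellman_value r q g N n x =
     (if n < N
      then Max (range (\<lambda>a. r x a + (\<Sum>x'\<in>UNIV. bellman_value r q g N (Suc n) x' * pmf (q x a) x')))
      else g x)"
  by auto
termination
  by (relation "Wellfounded.measure (\<lambda>(r, q, g, N, n, x). N - n)") simp_all

declare bellman_value.simps [simp del]

definition expected_total :: "('e \<Rightarrow> real) \<Rightarrow> ('e \<times> real) pmf \<Rightarrow> real" where
  "expected_total g F = (\<Sum>(x, s) \<in> set_pmf F. (g x + s) * pmf F (x, s))"

lemma expected_total_eq:
  fixes g :: "'e::finite \<Rightarrow> real"
  assumes "finite S" and "F \<in> dists (UNIV \<times> S)"
  shows "expected_total g F = (\<Sum>x\<in>UNIV. \<Sum>s\<in>S. (g x + s) * pmf F (x, s))"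
proof -
  have "expected_total g F = (\<Sum>(x, s) \<in> UNIV \<times> S. (g x + s) * pmf F (x, s))"
    unfolding expected_total_def
    by (rule sum.mono_neutral_left) (use assms in \<open>auto simp: dists_def set_pmf_iff\<close>)
  then show ?thesis
    by (simp add: sum.cartesian_product)
qed

lemma finite_reward_values:
  fixes r :: "'e::finite \<Rightarrow> 'a::finite \<Rightarrow> real"
  shows "finite (reward_values r g N)"
proof -
  have fin: "finite {acc_reward r xs as n | xs as. True}" for n
  proof (induction n)
    case 0
    have "{acc_reward r xs as 0 | xs as. True} = {0}"
      by (auto simp: acc_reward_def)
    then show ?case
      by simp
  next
    case (Suc n)
    have "{acc_reward r xs as (Suc n) | xs as. True}
        \<subseteq> (\<lambda>(s, x, a). s + r x a) ` ({acc_reward r xs as n | xs as. True} \<times> UNIV \<times> UNIV)"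
      by (force simp: acc_reward_def image_iff)
    then show ?case
      by (rule finite_subset) (use Suc in auto)
  qed
  have "reward_values r g N \<subseteq> (\<Union>n\<le>N. {acc_reward r xs as n | xs as. True})
      \<union> (\<lambda>(s, x). s + g x) ` ({acc_reward r xs as N | xs as. True} \<times> UNIV)"
    by (force simp: reward_values_def image_iff)
  then show ?thesis
    by (rule finite_subset) (use fin in auto)
qed

lemma lifted_transition_eq_bind:
  fixes r :: "'e::finite \<Rightarrow> 'a::finite \<Rightarrow> real"
    and q :: "'e \<Rightarrow> 'a \<Rightarrow> 'e pmf" and \<pi> :: "('e, 'a) rule"
  assumes fin: "finite (set_pmf F)"
  defines "G \<equiv> F \<bind> (\<lambda>(x, s). \<pi> (x, s) \<bind> (\<lambda>a. map_pmf (\<lambda>x'. (x', s + r x a)) (q x a)))"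
  shows "lifted_transition r q \<pi> F = G"
    and "pmf G (x', s') = (\<Sum>(x, s, a) \<in> {(x, s, a). r x a = s' - s}.
           pmf (q x a) x' * pmf (\<pi> (x, s)) a * pmf F (x, s))"
proof -
  have pmf_map: "pmf (map_pmf (\<lambda>x'. (x', s + r x a)) (q x a)) (y, t)
      = (if r x a = t - s then pmf (q x a) y else 0)" for x s a y t
  proof (cases "r x a = t - s")
    case True
    then have "(y, t) = (\<lambda>x'. (x', s + r x a)) y"
      by simp
    then show ?thesis
      using True pmf_map_inj'[of "\<lambda>x'. (x', s + r x a)" "q x a" y] by (simp add: inj_on_def)
  next
    case False
    then have "(y, t) \<notin> set_pmf (map_pmf (\<lambda>x'. (x', s + r x a)) (q x a))"
      by auto
    then have "pmf (map_pmf (\<lambda>x'. (x', s + r x a)) (q x a)) (y, t) = 0"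
      unfolding set_pmf_iff by simp
    then show ?thesis
      using False by simp
  qed
  have pmfG: "pmf G (y, t) = (\<Sum>(x, s, a) \<in> {(x, s, a). r x a = t - s}.
      pmf (q x a) y * pmf (\<pi> (x, s)) a * pmf F (x, s))" for y t
  proof -
    let ?I = "{(x, s, a). r x a = t - s}"
    let ?f = "\<lambda>x s a. pmf (q x a) y * pmf (\<pi> (x, s)) a * pmf F (x, s)"
    let ?A = "(\<lambda>((x, s), a). (x, s, a)) ` (set_pmf F \<times> (UNIV :: 'a set))"
    have memA: "(x, s, a) \<in> ?A \<longleftrightarrow> pmf F (x, s) \<noteq> 0" for x s a
      by (force simp: set_pmf_iff)
    have finI: "finite ?I"
    proof (rule finite_subset)
      show "?I \<subseteq> (\<lambda>(x, a). (x, t - r x a, a)) ` UNIV"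
        by (force simp: image_iff)
    qed simp
    have "pmf G (y, t) = (\<Sum>(x, s) \<in> set_pmf F. (\<Sum>a\<in>UNIV.
        (if r x a = t - s then pmf (q x a) y else 0) * pmf (\<pi> (x, s)) a) * pmf F (x, s))"
      unfolding G_def
      by (simp add: pmf_bind integral_measure_pmf_real[OF fin] case_prod_unfold
          integral_measure_pmf_real[of UNIV] pmf_map[unfolded case_prod_unfold])
    also have "\<dots> = (\<Sum>((x, s), a) \<in> set_pmf F \<times> UNIV. if r x a = t - s then ?f x s a else 0)"
      by (auto simp: sum.cartesian_product case_prod_unfold sum_distrib_right intro!: sum.cong)
    also have "\<dots> = (\<Sum>(x, s, a) \<in> ?A. if r x a = t - s then ?f x s a else 0)"
      by (subst sum.reindex) (auto simp: inj_on_def case_prod_unfold intro!: sum.cong)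
    also have "\<dots> = (\<Sum>(x, s, a) \<in> ?A \<inter> ?I. ?f x s a)"
      by (subst sum.inter_restrict) (use fin in \<open>auto simp: case_prod_unfold intro!: sum.cong\<close>)
    also have "\<dots> = (\<Sum>(x, s, a) \<in> ?I. ?f x s a)"
    proof (rule sum.mono_neutral_left[OF finI])
      show "\<forall>i \<in> ?I - ?A \<inter> ?I. (case i of (x, s, a) \<Rightarrow> ?f x s a) = 0"
      proof
        fix i assume i: "i \<in> ?I - ?A \<inter> ?I"
        obtain x s a where xsa: "i = (x, s, a)"
          by (cases i)
        have "(x, s, a) \<notin> ?A"
          using i unfolding xsa by blast
        then have "pmf F (x, s) = 0"
          unfolding memA by blast
        then show "(case i of (x, s, a) \<Rightarrow> ?f x s a) = 0"
          unfolding xsa by simp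
      qed
    qed auto
    finally show ?thesis .
  qed
  show "pmf G (x', s') = (\<Sum>(x, s, a) \<in> {(x, s, a). r x a = s' - s}.
      pmf (q x a) x' * pmf (\<pi> (x, s)) a * pmf F (x, s))"
    by (rule pmfG)
  have "lifted_transition r q \<pi> F = embed_pmf (pmf G)"
    unfolding lifted_transition_def
    by (rule arg_cong[where f = embed_pmf]) (auto simp: fun_eq_iff pmfG)
  also have "\<dots> = G"
    using type_definition.Rep_inverse[OF td_pmf_embed_pmf] .
  finally show "lifted_transition r q \<pi> F = G" .
qed

lemma pmf_lifted_transition:
  fixes r :: "'e::finite \<Rightarrow> 'a::finite \<Rightarrow> real"
  assumes "finite (set_pmf F)"
  shows "pmf (lifted_transition r q \<pi> F) (x', s') =
    (\<Sum>(x, s, a) \<in> {(x, s, a). r x a = s' - s}.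
       pmf (q x a) x' * pmf (\<pi> (x, s)) a * pmf F (x, s))"
  unfolding lifted_transition_eq_bind(1)[OF assms]
  by (rule lifted_transition_eq_bind(2)[OF assms])

lemma lifted_transition_accumulated:
  fixes r :: "'e::finite \<Rightarrow> 'a::finite \<Rightarrow> real"
  assumes "finite (set_pmf F)"
    and "F \<in> dists (UNIV \<times> {acc_reward r xs as n | xs as. True})"
  shows "lifted_transition r q \<pi> F \<in> dists (UNIV \<times> {acc_reward r xs as (Suc n) | xs as. True})"
proof -
  have step: "\<exists>xs' as'. acc_reward r xs as n + r x a = acc_reward r xs' as' (Suc n)"
    for xs as x a
    by (rule exI[of _ "xs(n := x)"], rule exI[of _ "as(n := a)"])
      (auto simp: acc_reward_def intro!: sum.cong)
  show ?thesis
    unfolding lifted_transition_eq_bind(1)[OF assms(1)]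
    using assms(2) step by (fastforce simp: dists_def)
qed

end

theory Submission
  imports Defs
begin

text \<open>
  The terminal reward \<open>expected_total g F\<close> is the \<open>F\<close>-expectation of
  $g(X) + R$, hence linear in \<open>F\<close>, and the lifted problem can be solved inside the family of
  functionals \<open>expected_total v\<close>. One transition under \<open>\<pi>\<close> followed by
  \<open>expected_total v\<close> replaces the integrand $v(x) + s$ by $s$ plus the
  $\pi(\cdot|x,s)$-average over \<open>a\<close> of $r(x,a) + \sum_{x'} v(x') q(x'|x,a)$
  (\<open>expected_total_lifted_transition\<close>). The accumulated reward enters only as a summand that
  no action affects, and an average over actions is at most the maximum, so the best decision rule
  is to play, in every \<open>(x, s)\<close>, a maximizer that depends on \<open>x\<close> alone. It turns
  \<open>v\<close> into the Bellman update of \<open>v\<close>, for all \<open>F\<close> at once.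

  Backward induction from \<open>N\<close> then bounds every strategy by
  \<open>expected_total V\<^sub>n F\<close> and shows that the greedy strategy attains this bound
  (\<open>strategy_value_le\<close>, \<open>strategy_value_greedy\<close>), and likewise that the recursively
  defined suprema equal it (\<open>lifted_value_eq\<close>). The formula of the theorem is
  \<open>expected_total V\<^sub>n F\<close> split into its two marginals. The inductions range over all
  finitely supported \<open>F\<close>, a class that the transition preserves, whereas it need not preserve
  the distributions on \<open>E \<times> S\<close>.
\<close>

definition action_value ::
    "('e::finite \<Rightarrow> 'a \<Rightarrow> real) \<Rightarrow> ('e \<Rightarrow> 'a \<Rightarrow> 'e pmf) \<Rightarrow> ('e \<Rightarrow> real) \<Rightarrow> 'e \<Rightarrow> 'a \<Rightarrow> real"
  where "action_value r q v x a = r x a + (\<Sum>x'\<in>UNIV. v x' * pmf (q x a) x')"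

definition greedy_action ::
    "('e::finite \<Rightarrow> 'a::finite \<Rightarrow> real) \<Rightarrow> ('e \<Rightarrow> 'a \<Rightarrow> 'e pmf) \<Rightarrow> ('e \<Rightarrow> real) \<Rightarrow> 'e \<Rightarrow> 'a"
  where "greedy_action r q v x = (SOME a. \<forall>b. action_value r q v x b \<le> action_value r q v x a)"

lemma action_value_le_greedy:
  "action_value r q v x b \<le> action_value r q v x (greedy_action r q v x)"
proof -
  have "Max (range (action_value r q v x)) \<in> range (action_value r q v x)"
    by (rule Max_in) auto
  then obtain a where "Max (range (action_value r q v x)) = action_value r q v x a"
    by blast
  then have "\<forall>b. action_value r q v x b \<le> action_value r q v x a"
    by (metis Max_ge finite finite_imageI rangeI)
  then have "\<forall>b. action_value r q v x b \<le> action_value r q v x (greedy_action r q v x)"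
    unfolding greedy_action_def by (rule someI)
  then show ?thesis ..
qed

lemma bellman_value_final: "n \<ge> N \<Longrightarrow> bellman_value r q g N n = g"
  by (auto simp: bellman_value.simps fun_eq_iff)

lemma bellman_value_step:
  fixes r :: "'e::finite \<Rightarrow> 'a::finite \<Rightarrow> real"
    and q :: "'e \<Rightarrow> 'a \<Rightarrow> 'e pmf" and g :: "'e \<Rightarrow> real"
  assumes "n < N"
  defines "v \<equiv> bellman_value r q g N (Suc n)"
  shows "bellman_value r q g N n x = action_value r q v x (greedy_action r q v x)"
proof -
  have "bellman_value r q g N n x = Max (range (action_value r q v x))"
    by (subst bellman_value.simps) (simp add: assms action_value_def)
  also have "\<dots> = action_value r q v x (greedy_action r q v x)"
    by (rule Max_eqI) (auto intro: action_value_le_greedy)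
  finally show ?thesis .
qed

lemma finite_set_lifted_transition:
  fixes r :: "'e::finite \<Rightarrow> 'a::finite \<Rightarrow> real"
  assumes "finite (set_pmf F)"
  shows "finite (set_pmf (lifted_transition r q \<pi> F))"
  unfolding lifted_transition_eq_bind(1)[OF assms] using assms
  by (auto simp: case_prod_unfold)

lemma expected_total_expectation:
  assumes "finite (set_pmf F)"
  shows "expected_total v F = measure_pmf.expectation F (\<lambda>(x, s). v x + s)"
  by (simp add: expected_total_def integral_measure_pmf_real[OF assms] case_prod_unfold)

text \<open>
  The next state and the reward increment are averaged out, conditionally on the current pair
  \<open>(x, s)\<close>; the old accumulated reward \<open>s\<close> comes out unchanged because all
  conditional probabilities sum to one.
\<close>

lemma expected_total_lifted_transition:
  fixes r :: "'e::finite \<Rightarrow> 'a::finite \<Rightarrow> real"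
  assumes fin: "finite (set_pmf F)"
  shows "expected_total v (lifted_transition r q \<pi> F) =
    (\<Sum>(x, s) \<in> set_pmf F.
       (s + (\<Sum>a\<in>UNIV. pmf (\<pi> (x, s)) a * action_value r q v x a)) * pmf F (x, s))"
proof -
  have one: "(\<Sum>i\<in>UNIV. pmf p i) = 1" for p :: "'i::finite pmf"
    by (rule sum_pmf_eq_1) auto
  have step: "measure_pmf.expectation (map_pmf (\<lambda>x'. (x', s + r x a)) (q x a)) (\<lambda>(x, s). v x + s)
      = s + action_value r q v x a" for x s a
    by (simp add: integral_measure_pmf_real[of UNIV] action_value_def distrib_right sum.distrib
        one flip: sum_distrib_left)
  have act: "measure_pmf.expectation
        (\<pi> (x, s) \<bind> (\<lambda>a. map_pmf (\<lambda>x'. (x', s + r x a)) (q x a))) (\<lambda>(x, s). v x + s)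
      = s + (\<Sum>a\<in>UNIV. pmf (\<pi> (x, s)) a * action_value r q v x a)" for x s
    by (subst pmf_expectation_bind[of UNIV])
      (auto simp: step distrib_left sum.distrib one simp del: integral_map_pmf
        simp flip: sum_distrib_right)
  show ?thesis
    unfolding expected_total_expectation[OF finite_set_lifted_transition[OF fin]]
    unfolding lifted_transition_eq_bind(1)[OF fin]
    by (subst pmf_expectation_bind[OF fin])
      (auto simp: act[unfolded case_prod_unfold] case_prod_unfold mult.commute simp del: integral_map_pmf intro!: sum.cong)
qed

text \<open>Randomizing cannot help: an average over actions is at most the largest action value.\<close>

lemma expected_total_lifted_transition_le:
  fixes r :: "'e::finite \<Rightarrow> 'a::finite \<Rightarrow> real"
  assumes "finite (set_pmf F)" and "n < N"
  shows "expected_total (bellman_value r q g N (Suc n)) (lifted_transition r q \<pi> F)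
    \<le> expected_total (bellman_value r q g N n) F"
proof -
  let ?v = "bellman_value r q g N (Suc n)"
  have avg: "(\<Sum>a\<in>UNIV. pmf (\<pi> (x, s)) a * action_value r q ?v x a) \<le> bellman_value r q g N n x"
    for x s
  proof -
    have "(\<Sum>a\<in>UNIV. pmf (\<pi> (x, s)) a * action_value r q ?v x a)
        \<le> (\<Sum>a\<in>UNIV. pmf (\<pi> (x, s)) a * bellman_value r q g N n x)"
      unfolding bellman_value_step[OF assms(2)]
      by (intro sum_mono mult_left_mono action_value_le_greedy) auto
    also have "\<dots> = bellman_value r q g N n x"
      by (simp add: sum_pmf_eq_1 flip: sum_distrib_right)
    finally show ?thesis .
  qed
  show ?thesis
    unfolding expected_total_lifted_transition[OF assms(1)] expected_total_def[of _ F]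
    by (rule sum_mono) (use avg in \<open>auto intro!: mult_right_mono simp: add.commute\<close>)
qed

definition greedy_rule ::
    "('e::finite \<Rightarrow> 'a::finite \<Rightarrow> real) \<Rightarrow> ('e \<Rightarrow> 'a \<Rightarrow> 'e pmf) \<Rightarrow> ('e \<Rightarrow> real) \<Rightarrow> nat
      \<Rightarrow> nat \<Rightarrow> 'e \<times> real \<Rightarrow> 'a" where
  "greedy_rule r q g N n y = greedy_action r q (bellman_value r q g N (Suc n)) (fst y)"

lemma expected_total_lifted_transition_greedy:
  fixes r :: "'e::finite \<Rightarrow> 'a::finite \<Rightarrow> real"
  assumes "finite (set_pmf F)" and "n < N"
  shows "expected_total (bellman_value r q g N (Suc n))
      (lifted_transition r q (\<lambda>y. return_pmf (greedy_rule r q g N n y)) F)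
    = expected_total (bellman_value r q g N n) F"
  unfolding expected_total_lifted_transition[OF assms(1)] expected_total_def[of _ F]
    bellman_value_step[OF assms(2)]
  by (intro sum.cong)
    (auto simp: greedy_rule_def indicator_def if_distrib[of "\<lambda>c. c * _"] cong: if_cong)

lemma strategy_value_le:
  fixes r :: "'e::finite \<Rightarrow> 'a::finite \<Rightarrow> real"
  assumes "n \<le> N" and "finite (set_pmf F)"
  shows "strategy_value r q (expected_total g) N \<tau> n F
    \<le> expected_total (bellman_value r q g N n) F"
  using assms
proof (induction n arbitrary: F rule: inc_induct)
  case base
  then show ?case
    by (simp add: strategy_value.simps bellman_value_final)
next
  case (step n)
  have "strategy_value r q (expected_total g) N \<tau> n F
      = strategy_value r q (expected_total g) N \<tau> (Suc n) (lifted_transition r q (\<tau> n) F)"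
    by (subst strategy_value.simps) (simp add: step.hyps)
  also have "\<dots> \<le> expected_total (bellman_value r q g N (Suc n)) (lifted_transition r q (\<tau> n) F)"
    by (intro step.IH finite_set_lifted_transition step.prems)
  also have "\<dots> \<le> expected_total (bellman_value r q g N n) F"
    by (intro expected_total_lifted_transition_le step)
  finally show ?case .
qed

lemma strategy_value_greedy:
  fixes r :: "'e::finite \<Rightarrow> 'a::finite \<Rightarrow> real"
  assumes "n \<le> N" and "finite (set_pmf F)"
  shows "strategy_value r q (expected_total g) N (\<lambda>k y. return_pmf (greedy_rule r q g N k y)) n F
    = expected_total (bellman_value r q g N n) F"
  using assms
proof (induction n arbitrary: F rule: inc_induct)
  case base
  then show ?case
    by (simp add: strategy_value.simps bellman_value_final)
next
  case (step n)
  then show ?case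
    by (subst strategy_value.simps)
      (simp add: finite_set_lifted_transition expected_total_lifted_transition_greedy)
qed

text \<open>
  The supremum over decision rules is a maximum, attained by the greedy rule; the real-valued
  supremum would carry no information if the values were unbounded.
\<close>

lemma lifted_value_eq:
  fixes r :: "'e::finite \<Rightarrow> 'a::finite \<Rightarrow> real"
  assumes "n \<le> N" and "finite (set_pmf F)"
  shows "lifted_value r q (expected_total g) N n F = expected_total (bellman_value r q g N n) F"
  using assms
proof (induction n arbitrary: F rule: inc_induct)
  case base
  then show ?case
    by (simp add: lifted_value.simps bellman_value_final)
next
  case (step n)
  let ?J = "\<lambda>\<pi>. expected_total (bellman_value r q g N (Suc n)) (lifted_transition r q \<pi> F)"
  have "lifted_value r q (expected_total g) N n F = (SUP \<pi>. ?J \<pi>)"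
    by (subst lifted_value.simps)
      (simp add: step.hyps step.IH finite_set_lifted_transition step.prems)
  also have "\<dots> = expected_total (bellman_value r q g N n) F"
  proof (rule cSup_eq_maximum)
    show "expected_total (bellman_value r q g N n) F \<in> range ?J"
      by (rule range_eqI[where x = "\<lambda>y. return_pmf (greedy_rule r q g N n y)"])
        (use step in \<open>simp add: expected_total_lifted_transition_greedy\<close>)
  qed (use step in \<open>auto intro: expected_total_lifted_transition_le\<close>)
  finally show ?case .
qed

lemma expected_total_marginals:
  fixes v :: "'e::finite \<Rightarrow> real"
  assumes "finite S" and "F \<in> dists (UNIV \<times> S)"
  shows "expected_total v F = (\<Sum>s\<in>S. s * (\<Sum>x\<in>UNIV. pmf F (x, s))) +
    (\<Sum>x\<in>UNIV. (\<Sum>s\<in>S. pmf F (x, s)) * v x)"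
proof -
  have "expected_total v F
      = (\<Sum>x\<in>UNIV. \<Sum>s\<in>S. s * pmf F (x, s)) + (\<Sum>x\<in>UNIV. \<Sum>s\<in>S. pmf F (x, s) * v x)"
    unfolding expected_total_eq[OF assms] by (simp add: sum.distrib[symmetric] algebra_simps)
  also have "(\<Sum>x\<in>UNIV. \<Sum>s\<in>S. s * pmf F (x, s)) = (\<Sum>s\<in>S. s * (\<Sum>x\<in>UNIV. pmf F (x, s)))"
    by (subst sum.swap) (simp add: sum_distrib_left)
  finally show ?thesis
    by (simp add: sum_distrib_right)
qed

theorem mainTheorem5:
  fixes r :: "'e::finite \<Rightarrow> 'a::finite \<Rightarrow> real"
    and q :: "'e \<Rightarrow> 'a \<Rightarrow> 'e pmf"
    and g :: "'e \<Rightarrow> real"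
    and N :: nat
  defines "S \<equiv> reward_values r g N"
    and "H \<equiv> expected_total g"
  shows "(\<forall>n\<le>N. \<forall>F \<in> dists (UNIV \<times> S).
           lifted_value r q H N n F =
             (\<Sum>s\<in>S. s * (\<Sum>x\<in>UNIV. pmf F (x, s))) +
             (\<Sum>x\<in>UNIV. (\<Sum>s\<in>S. pmf F (x, s)) * bellman_value r q g N n x)) \<and>
         (\<exists>f :: nat \<Rightarrow> 'e \<times> real \<Rightarrow> 'a. \<forall>n\<le>N. \<forall>F \<in> dists (UNIV \<times> S).
           optimal_strategy r q H N (\<lambda>k y. return_pmf (f k y)) n F \<and>
           strategy_value r q H N (\<lambda>k y. return_pmf (f k y)) n F = lifted_value r q H N n F)"
proof -
  have fin_S: "finite S"
    unfolding S_def by (rule finite_reward_values)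
  have fin_F: "finite (set_pmf F)" if "F \<in> dists (UNIV \<times> S)" for F :: "('e \<times> real) pmf"
    using that fin_S by (auto simp: dists_def intro: finite_subset)
  show ?thesis
  proof (intro conjI allI impI ballI exI[of _ "greedy_rule r q g N"])
    fix n and F :: "('e \<times> real) pmf"
    assume n: "n \<le> N" and F: "F \<in> dists (UNIV \<times> S)"
    note fin = fin_F[OF F]
    show "lifted_value r q H N n F =
        (\<Sum>s\<in>S. s * (\<Sum>x\<in>UNIV. pmf F (x, s))) +
        (\<Sum>x\<in>UNIV. (\<Sum>s\<in>S. pmf F (x, s)) * bellman_value r q g N n x)"
      unfolding H_def lifted_value_eq[OF n fin] by (rule expected_total_marginals[OF fin_S F])
    show "optimal_strategy r q H N (\<lambda>k y. return_pmf (greedy_rule r q g N k y)) n F"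
      unfolding optimal_strategy_def H_def strategy_value_greedy[OF n fin]
      by (intro allI strategy_value_le[OF n fin])
    show "strategy_value r q H N (\<lambda>k y. return_pmf (greedy_rule r q g N k y)) n F
        = lifted_value r q H N n F"
      unfolding H_def strategy_value_greedy[OF n fin] lifted_value_eq[OF n fin] ..
  qed
qed

end
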